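(* Let $\mathbb F$ be an algebraically closed field, let $q\in\mathbb F$ be nonzero and not a root of unity, let $d\ge1$ be an integer, and let $t\in\mathbb F$ be nonzero and not among $\{q^{d-2n+1}\}_{n=1}^d$. On the $\boxtimes_q$-module $\mathbf V_d(t)$, $$t(x_{01}-x_{02})=\frac{[x_{30},x_{02}]}{q-q^{-1}},\qquad t^{-1}(x_{12}-x_{13})=\frac{[x_{01},x_{13}]}{q-q^{-1}},$$ $$t(x_{23}-x_{20})=\frac{[x_{12},x_{20}]}{q-q^{-1}},\qquad t^{-1}(x_{30}-x_{31})=\frac{[x_{23},x_{31}]}{q-q^{-1}},$$ and also $$t^{-1}(x_{30}-x_{20})=\frac{[x_{20},x_{01}]}{q-q^{-1}},\qquad t(x_{01}-x_{31})=\frac{[x_{31},x_{12}]}{q-q^{-1}},$$ $$t^{-1}(x_{12}-x_{02})=\frac{[x_{02},x_{23}]}{q-q^{-1}},\qquad t(x_{23}-x_{13})=\frac{[x_{13},x_{30}]}{q-q^{-1}}.$$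
   Context: Algebras are associative with 1. $[n]_q=(q^n-q^{-n})/(q-q^{-1})$, $\mathbb Z_4=\mathbb Z/4\mathbb Z$, and $[u,v]=uv-vu$. The $q$-tetrahedron algebra $\boxtimes_q$ is the $\mathbb F$-algebra with generators (called the standard generators) $\{x_{ij}\mid i,j\in\mathbb Z_4,\ j-i=1\text{ or }j-i=2\}$ and relations: (i) $x_{ij}x_{ji}=1$ if $j-i=2$; (ii) $\frac{qx_{ij}x_{jk}-q^{-1}x_{jk}x_{ij}}{q-q^{-1}}=1$ if $(j-i,k-j)$ is one of $(1,1),(1,2),(2,1)$; (iii) $x_{ij}^3x_{k\ell}-[3]_qx_{ij}^2x_{k\ell}x_{ij}+[3]_qx_{ij}x_{k\ell}x_{ij}^2-x_{k\ell}x_{ij}^3=0$ if $j-i=k-j=\ell-k=1$. Matrices in ${\rm Mat}_{d+1}(\mathbb F)$ have rows and columns indexed by $0,\dots,d$; $M$ represents $A$ with respect to a basis $\{v_n\}_{n=0}^d$ when $Av_n=\sum_i M_{in}v_i$. Entries not mentioned below are $0$. A subscript $q^{-1}$ means that $q$ is replaced by $q^{-1}$ in the definition (and similarly $t^{-1}$ as argument). - $Z$: $(i,j)$-entry $\delta_{i+j,d}$. - $K_q$: diagonal, $(i,i)$-entry $q^{d-2i}$. - $E_q$: $(i,i)$-entry $q^{2i-d}$; $(i-1,i)$-entry $q^d-q^{2i-2-d}$. - $G_q(t)$: $(i,i)$-entry $q^{2i-d}$; $(i-1,i)$-entry $(q^d-q^{2i-2-d})(1-tq^{d-2i+1})$.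 - $L_q(t)$: $(i,i)$-entry $q^{2i-d}$; $(i-1,i)$-entry $(q^d-q^{2i-2-d})(1-tq^{d-2i+1})^{-1}$. - $S_q(t)$: $(i-1,i)$-entry $(q^d-q^{2i-d-2})(1-tq^{2i-d-1})$; $(i,i-1)$-entry $(q^{2i-d}-q^{-d})q^{2i-d-1}t$; $(i,i)$-entry $q^d-(q^{2i-d}-q^{-d})q^{2i-d-1}t-(q^d-q^{2i-d})(1-tq^{2i-d+1})$. $\mathbf V_d(t)$ is the $(d+1)$-dimensional $\boxtimes_q$-module having a basis with respect to which the standard generators are represented by: $x_{01}: ZS_{q^{-1}}(t^{-1})Z$, $x_{12}: E_q$, $x_{23}: K_q$, $x_{30}: ZG_{q^{-1}}(t)Z$, $x_{02}: L_q(t)$, $x_{13}: (ZE_{q^{-1}}Z)^{-1}$, $x_{20}: (L_q(t))^{-1}$, $x_{31}: ZE_{q^{-1}}Z$. *)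

theory Defs
  imports
    "HOL-Library.Poly_Mapping"
    "HOL-Library.Numeral_Type"
    "HOL-Computational_Algebra.Polynomial"
    "HOL-Algebra.QuotRing"
    "Jordan_Normal_Form.Matrix"
begin

text \<open>
  The indices are taken in the type \<open>4\<close> of \<^theory>\<open>HOL-Library.Numeral_Type\<close>, whose
  arithmetic is arithmetic modulo 4.
\<close>

typedef tet_gen = "{(i, j). j - i = 1 \<or> j - i = 2} :: (4 \<times> 4) set"
  by (rule exI[of _ "(0, 1)"]) simp

text \<open>
  Words in the generators, with concatenation written additively: \<^theory>\<open>HOL-Library.Poly_Mapping\<close>
  then makes \<open>tet_word \<Rightarrow>\<^sub>0 'f\<close> the monoid algebra of the free monoid, that is, the free
  associative unital algebra on the generators.
\<close>

datatype tet_word = Word (letters: "tet_gen list")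

instantiation tet_word :: monoid_add
begin

definition zero_tet_word :: tet_word where
  "0 = Word []"

definition plus_tet_word :: "tet_word \<Rightarrow> tet_word \<Rightarrow> tet_word" where
  "u + w = Word (letters u @ letters w)"

instance
  by standard (auto simp: zero_tet_word_def plus_tet_word_def)

end

type_synonym 'f tet_free = "tet_word \<Rightarrow>\<^sub>0 'f"

definition free_x :: "4 \<Rightarrow> 4 \<Rightarrow> 'f::field tet_free" where
  "free_x i j = Poly_Mapping.single (Word [Abs_tet_gen (i, j)]) 1"

definition free_const :: "'f::field \<Rightarrow> 'f tet_free" where
  "free_const c = Poly_Mapping.single 0 c"

definition q_number :: "'f::field \<Rightarrow> nat \<Rightarrow> 'f" where
  "q_number q n = (q ^ n - inverse q ^ n) / (q - inverse q)"

text \<open>Each relation \<open>a = b\<close> is recorded as the element \<open>a - b\<close> of the free algebra.\<close>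

definition tet_relations :: "'f::field \<Rightarrow> 'f tet_free set" where
  "tet_relations q =
     {free_x i j * free_x j i - 1 | i j. j - i = 2} \<union>
     {free_const (inverse (q - inverse q)) *
        (free_const q * free_x i j * free_x j k - free_const (inverse q) * free_x j k * free_x i j) - 1
      | i j k. (j - i, k - j) \<in> {(1, 1), (1, 2), (2, 1)}} \<union>
     {free_x i j ^ 3 * free_x k l
        - free_const (q_number q 3) * free_x i j ^ 2 * free_x k l * free_x i j
        + free_const (q_number q 3) * free_x i j * free_x k l * free_x i j ^ 2
        - free_x k l * free_x i j ^ 3
      | i j k l. j - i = 1 \<and> k - j = 1 \<and> l - k = 1}"

definition free_ring :: "'f::field tet_free ring" where
  "free_ring = \<lparr>carrier = UNIV, monoid.mult = (*), one = 1, zero = 0, add = (+)\<rparr>"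

definition tet_ideal :: "'f::field \<Rightarrow> 'f tet_free set" where
  "tet_ideal q = Idl\<^bsub>free_ring\<^esub> (tet_relations q)"

definition qtet :: "'f::field \<Rightarrow> 'f tet_free set ring" where
  "qtet q = free_ring Quot tet_ideal q"

definition tet_smult :: "'f::field \<Rightarrow> 'f \<Rightarrow> 'f tet_free set \<Rightarrow> 'f tet_free set" where
  "tet_smult q c a = (tet_ideal q +>\<^bsub>free_ring\<^esub> free_const c) \<otimes>\<^bsub>qtet q\<^esub> a"

definition tet_x :: "'f::field \<Rightarrow> 4 \<Rightarrow> 4 \<Rightarrow> 'f tet_free set" where
  "tet_x q i j = tet_ideal q +>\<^bsub>free_ring\<^esub> free_x i j"

definition tet_comm :: "'f::field \<Rightarrow> 'f tet_free set \<Rightarrow> 'f tet_free set \<Rightarrow> 'f tet_free set" where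
  "tet_comm q u v = (u \<otimes>\<^bsub>qtet q\<^esub> v) \<ominus>\<^bsub>qtet q\<^esub> (v \<otimes>\<^bsub>qtet q\<^esub> u)"

locale qtet_module = vector_space scale
  for scale :: "'f::field \<Rightarrow> 'v::ab_group_add \<Rightarrow> 'v" +
  fixes q :: 'f
    and act :: "'f tet_free set \<Rightarrow> 'v \<Rightarrow> 'v"
  assumes act_vec_add: "a \<in> carrier (qtet q) \<Longrightarrow> act a (u + v) = act a u + act a v"
    and act_add: "a \<in> carrier (qtet q) \<Longrightarrow> b \<in> carrier (qtet q) \<Longrightarrow>
      act (a \<oplus>\<^bsub>qtet q\<^esub> b) v = act a v + act b v"
    and act_mult: "a \<in> carrier (qtet q) \<Longrightarrow> b \<in> carrier (qtet q) \<Longrightarrow>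
      act (a \<otimes>\<^bsub>qtet q\<^esub> b) v = act a (act b v)"
    and act_one: "act \<one>\<^bsub>qtet q\<^esub> v = v"
    and act_smult: "a \<in> carrier (qtet q) \<Longrightarrow> act (tet_smult q c a) v = scale c (act a v)"

text \<open>
  In the matrices below the superdiagonal entries are described by the column index \<open>j\<close> and the
  subdiagonal entries by the row index \<open>i\<close>.
\<close>

definition Z_mat :: "nat \<Rightarrow> 'f::field mat" where
  "Z_mat d = mat (d + 1) (d + 1) (\<lambda>(i, j). if i + j = d then 1 else 0)"

definition K_mat :: "nat \<Rightarrow> 'f::field \<Rightarrow> 'f mat" where
  "K_mat d q = mat (d + 1) (d + 1) (\<lambda>(i, j). if i = j then q powi (int d - 2 * int i) else 0)"

definition E_mat :: "nat \<Rightarrow> 'f::field \<Rightarrow> 'f mat" where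
  "E_mat d q = mat (d + 1) (d + 1) (\<lambda>(i, j).
     if i = j then q powi (2 * int i - int d)
     else if j = i + 1 then q powi int d - q powi (2 * int j - 2 - int d)
     else 0)"

definition G_mat :: "nat \<Rightarrow> 'f::field \<Rightarrow> 'f \<Rightarrow> 'f mat" where
  "G_mat d q t = mat (d + 1) (d + 1) (\<lambda>(i, j).
     if i = j then q powi (2 * int i - int d)
     else if j = i + 1 then
       (q powi int d - q powi (2 * int j - 2 - int d)) * (1 - t * q powi (int d - 2 * int j + 1))
     else 0)"

definition L_mat :: "nat \<Rightarrow> 'f::field \<Rightarrow> 'f \<Rightarrow> 'f mat" where
  "L_mat d q t = mat (d + 1) (d + 1) (\<lambda>(i, j).
     if i = j then q powi (2 * int i - int d)
     else if j = i + 1 then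
       (q powi int d - q powi (2 * int j - 2 - int d)) *
         inverse (1 - t * q powi (int d - 2 * int j + 1))
     else 0)"

definition S_mat :: "nat \<Rightarrow> 'f::field \<Rightarrow> 'f \<Rightarrow> 'f mat" where
  "S_mat d q t = mat (d + 1) (d + 1) (\<lambda>(i, j).
     if j = i + 1 then
       (q powi int d - q powi (2 * int j - int d - 2)) * (1 - t * q powi (2 * int j - int d - 1))
     else if i = j + 1 then
       (q powi (2 * int i - int d) - q powi (- int d)) * q powi (2 * int i - int d - 1) * t
     else if i = j then
       q powi int d
         - (q powi (2 * int i - int d) - q powi (- int d)) * q powi (2 * int i - int d - 1) * t
         - (q powi int d - q powi (2 * int i - int d)) * (1 - t * q powi (2 * int i - int d + 1))
     else 0)"

definition inv_mat :: "nat \<Rightarrow> 'f::field mat \<Rightarrow> 'f mat" where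
  "inv_mat d M = inv\<^bsub>ring_mat TYPE('f) (d + 1) ()\<^esub> M"

definition is_basis :: "('f::field \<Rightarrow> 'v::ab_group_add \<Rightarrow> 'v) \<Rightarrow> nat \<Rightarrow> (nat \<Rightarrow> 'v) \<Rightarrow> bool" where
  "is_basis scale d v \<longleftrightarrow>
     inj_on v {..d} \<and> \<not> module.dependent scale (v ` {..d}) \<and> module.span scale (v ` {..d}) = UNIV"

definition represents ::
  "('f::field \<Rightarrow> 'v::ab_group_add \<Rightarrow> 'v) \<Rightarrow> nat \<Rightarrow> (nat \<Rightarrow> 'v) \<Rightarrow> 'f mat \<Rightarrow> ('v \<Rightarrow> 'v) \<Rightarrow> bool" where
  "represents scale d v M A \<longleftrightarrow> (\<forall>n\<le>d. A (v n) = (\<Sum>i\<le>d. scale (M $$ (i, n)) (v i)))"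

definition is_V ::
  "('f::field \<Rightarrow> 'v::ab_group_add \<Rightarrow> 'v) \<Rightarrow> 'f \<Rightarrow> ('f tet_free set \<Rightarrow> 'v \<Rightarrow> 'v) \<Rightarrow> nat \<Rightarrow> 'f \<Rightarrow> bool" where
  "is_V scale q act d t \<longleftrightarrow>
     qtet_module scale q act \<and>
     (\<exists>v. is_basis scale d v \<and>
        represents scale d v (Z_mat d * S_mat d (inverse q) (inverse t) * Z_mat d) (act (tet_x q 0 1)) \<and>
        represents scale d v (E_mat d q) (act (tet_x q 1 2)) \<and>
        represents scale d v (K_mat d q) (act (tet_x q 2 3)) \<and>
        represents scale d v (Z_mat d * G_mat d (inverse q) t * Z_mat d) (act (tet_x q 3 0)) \<and>
        represents scale d v (L_mat d q t) (act (tet_x q 0 2)) \<and>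
        represents scale d v (inv_mat d (Z_mat d * E_mat d (inverse q) * Z_mat d)) (act (tet_x q 1 3)) \<and>
        represents scale d v (inv_mat d (L_mat d q t)) (act (tet_x q 2 0)) \<and>
        represents scale d v (Z_mat d * E_mat d (inverse q) * Z_mat d) (act (tet_x q 3 1)))"

end

theory Submission
  imports Defs
begin

text \<open>
  In every commutator of the
  theorem the two generators are \<open>x\<^sub>i\<^sub>j\<close> and \<open>x\<^sub>j\<^sub>k\<close> with \<open>(j - i, k - j)\<close> equal to \<open>(1, 2)\<close> or
  \<open>(2, 1)\<close>, so they satisfy the \<open>q\<close>-Weyl relation of the algebra. That relation makes
  \<open>[x\<^sub>i\<^sub>j, x\<^sub>j\<^sub>k] / (q - q\<^sup>-\<^sup>1)\<close> equal both to \<open>q (1 - x\<^sub>i\<^sub>j x\<^sub>j\<^sub>k)\<close> and to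
  \<open>q\<^sup>-\<^sup>1 (1 - x\<^sub>j\<^sub>k x\<^sub>i\<^sub>j)\<close> (\<open>q_commutator_left\<close>, \<open>q_commutator_right\<close>). Each of the eight identities
  thereby becomes a relation \<open>c (A - B) = e (1 - B C)\<close> in which a single product occurs.

  Multiplying such a relation on the left by \<open>B\<^sup>-\<^sup>1\<close> gives
  \<open>c\<^sup>-\<^sup>1 (C - B\<^sup>-\<^sup>1) = e\<^sup>-\<^sup>1 (1 - B\<^sup>-\<^sup>1 A)\<close>, which is again of this form
  (\<open>product_relation_dual\<close>). Since \<open>x\<^sub>0\<^sub>2, x\<^sub>2\<^sub>0\<close> and \<open>x\<^sub>1\<^sub>3, x\<^sub>3\<^sub>1\<close> are inverse pairs, this exchanges
  the first identity with the fifth, the second with the sixth, the third with the seventh and the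
  fourth with the eighth. One identity of each pair is left, and it can be chosen so that
  \<open>x\<^sub>2\<^sub>0\<close> and \<open>x\<^sub>1\<^sub>3\<close> do not occur; no inverse matrix is ever computed:
  \<open>t (x\<^sub>0\<^sub>1 - x\<^sub>0\<^sub>2) = q\<^sup>-\<^sup>1 (1 - x\<^sub>0\<^sub>2 x\<^sub>3\<^sub>0)\<close>, \<open>t (x\<^sub>0\<^sub>1 - x\<^sub>3\<^sub>1) = q (1 - x\<^sub>3\<^sub>1 x\<^sub>1\<^sub>2)\<close>,
  \<open>t\<^sup>-\<^sup>1 (x\<^sub>1\<^sub>2 - x\<^sub>0\<^sub>2) = q (1 - x\<^sub>0\<^sub>2 x\<^sub>2\<^sub>3)\<close> and \<open>t\<^sup>-\<^sup>1 (x\<^sub>3\<^sub>0 - x\<^sub>3\<^sub>1) = q\<^sup>-\<^sup>1 (1 - x\<^sub>3\<^sub>1 x\<^sub>2\<^sub>3)\<close>.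

  In these the matrix of \<open>x\<^sub>0\<^sub>1\<close> is tridiagonal, the others are bidiagonal or diagonal, and every
  product is upper times lower bidiagonal, lower times upper bidiagonal, or bidiagonal times
  diagonal. So both sides send the \<open>k\<close>-th basis vector to a combination of its two neighbours and
  itself, and the four identities come down to comparing three coefficients.
\<close>

section \<open>Modules of the q-tetrahedron algebra\<close>

lemma minus_two_4: "- (2::4) = 2" by simp

text \<open>
  Scalars are central in the free algebra, which is what makes every element of the quotient act
  linearly.
\<close>

lemma free_const_commute: "free_const c * a = a * free_const c"
proof (induction a rule: update_induct)
  case const
  show ?case by simp
next
  case (update a w b)
  have "Poly_Mapping.update w b a = Poly_Mapping.single w b + a"
    using update.hyps
    by (intro poly_mapping_eqI) (auto simp: lookup_update lookup_add lookup_single in_keys_iff when_def)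
  with update.IH show ?case
    by (simp add: free_const_def mult_single distrib_left distrib_right mult.commute)
qed

lemma ring_free_ring: "ring (free_ring :: 'f::field tet_free ring)"
  unfolding free_ring_def
  by (rule ringI, unfold_locales)
     (auto simp: algebra_simps Units_def intro: exI[of _ "- x" for x])

lemma carrier_free [simp]: "carrier free_ring = UNIV"
  and mult_free [simp]: "a \<otimes>\<^bsub>free_ring\<^esub> b = a * b"
  and one_free [simp]: "\<one>\<^bsub>free_ring\<^esub> = 1"
  and zero_free [simp]: "\<zero>\<^bsub>free_ring\<^esub> = 0"
  and add_free [simp]: "a \<oplus>\<^bsub>free_ring\<^esub> b = a + b"
  by (simp_all add: free_ring_def)

lemma ideal_tet_ideal: "ideal (tet_ideal q) free_ring"
  unfolding tet_ideal_def by (rule ring.genideal_ideal[OF ring_free_ring]) simp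

lemma coset_hom:
  "ring_hom_ring free_ring (qtet q) (\<lambda>a. tet_ideal q +>\<^bsub>free_ring\<^esub> a)"
  unfolding qtet_def by (rule ideal.rcos_ring_hom_ring[OF ideal_tet_ideal])

lemma coset_relation:
  assumes "a \<in> tet_relations q"
  shows "tet_ideal q +>\<^bsub>free_ring\<^esub> a = \<zero>\<^bsub>qtet q\<^esub>"
proof -
  interpret ideal "tet_ideal q" free_ring by (rule ideal_tet_ideal)
  have "a \<in> tet_ideal q"
    using assms genideal_self[of "tet_relations q"] by (auto simp: tet_ideal_def)
  then show ?thesis
    using a_rcos_const[of a] by (simp add: qtet_def FactRing_def)
qed

context qtet_module
begin

text \<open>
  The module seen as a module over the free algebra, where elements are polynomials and not cosets,
  so that a defining relation can be expanded with the laws of a type-class ring.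
\<close>

definition free_act :: "'f tet_free \<Rightarrow> 'v \<Rightarrow> 'v" where
  "free_act a = act (tet_ideal q +>\<^bsub>free_ring\<^esub> a)"

lemma free_act_vec_add: "free_act a (u + v) = free_act a u + free_act a v"
  unfolding free_act_def
  by (rule act_vec_add) (rule ring_hom_closed[OF ring_hom_ring.homh[OF coset_hom]], simp)

lemma coset_carrier [simp]: "tet_ideal q +>\<^bsub>free_ring\<^esub> a \<in> carrier (qtet q)"
  by (rule ring_hom_closed[OF ring_hom_ring.homh[OF coset_hom]]) simp

lemma free_act_add: "free_act (a + b) v = free_act a v + free_act b v"
  using ring_hom_add[OF ring_hom_ring.homh[OF coset_hom], of a b q] act_add[of _ _ v]
  by (simp add: free_act_def)

lemma free_act_mult: "free_act (a * b) v = free_act a (free_act b v)"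
  using ring_hom_mult[OF ring_hom_ring.homh[OF coset_hom], of a b q] act_mult[of _ _ v]
  by (simp add: free_act_def)

lemma free_act_one: "free_act 1 v = v"
  using ring_hom_one[OF ring_hom_ring.homh[OF coset_hom], of q] act_one[of v]
  by (simp add: free_act_def)

lemma free_act_diff: "free_act (a - b) v = free_act a v - free_act b v"
  using free_act_add[of "a - b" b v] by (simp add: algebra_simps)

lemma free_act_const: "free_act (free_const c) v = scale c v"
proof -
  interpret Q: ring "qtet q" using coset_hom ring_hom_ring.axioms(2) by blast
  have "tet_smult q c \<one>\<^bsub>qtet q\<^esub> = tet_ideal q +>\<^bsub>free_ring\<^esub> free_const c"
    by (simp add: tet_smult_def)
  then show ?thesis
    using act_smult[of "\<one>\<^bsub>qtet q\<^esub>" c v] by (simp add: free_act_def act_one)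
qed

lemma free_act_scale: "free_act a (scale c v) = scale c (free_act a v)"
  by (metis free_act_const free_act_mult free_const_commute)

lemma free_act_linear: "Vector_Spaces.linear scale scale (free_act a)"
  using module_axioms unfolding module_hom_iff_linear[symmetric]
  by (auto simp: module_hom_def module_hom_axioms_def free_act_vec_add free_act_scale)

lemma free_act_relation:
  assumes "a \<in> tet_relations q"
  shows "free_act a v = 0"
proof -
  interpret Q: ring "qtet q" using coset_hom ring_hom_ring.axioms(2) by blast
  have "act \<zero>\<^bsub>qtet q\<^esub> v = 0"
    using act_add[of "\<zero>\<^bsub>qtet q\<^esub>" "\<zero>\<^bsub>qtet q\<^esub>" v] by simp
  then show ?thesis by (simp add: free_act_def coset_relation[OF assms])
qed

abbreviation X :: "4 \<Rightarrow> 4 \<Rightarrow> 'v \<Rightarrow> 'v" where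
  "X i j \<equiv> act (tet_x q i j)"

lemma X_eq: "X i j = free_act (free_x i j)"
  by (simp add: free_act_def tet_x_def)

lemma X_inverse:
  assumes "j - i = 2"
  shows "X i j (X j i v) = v"
proof -
  have "free_x i j * free_x j i - 1 \<in> tet_relations q"
    using assms by (auto simp: tet_relations_def)
  from free_act_relation[OF this, of v] show ?thesis
    by (simp add: X_eq free_act_diff free_act_mult free_act_one)
qed

lemma X_weyl:
  assumes "(j - i, k - j) \<in> {(1, 1), (1, 2), (2, 1)}" "q - inverse q \<noteq> 0"
  shows "scale q (X i j (X j k v)) - scale (inverse q) (X j k (X i j v)) = scale (q - inverse q) v"
proof -
  have "free_const (inverse (q - inverse q)) *
        (free_const q * free_x i j * free_x j k - free_const (inverse q) * free_x j k * free_x i j) - 1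
      \<in> tet_relations q"
    using assms by (auto simp: tet_relations_def)
  from free_act_relation[OF this, of v]
  have "scale (inverse (q - inverse q))
     (scale q (X i j (X j k v)) - scale (inverse q) (X j k (X i j v))) = v"
    by (simp add: X_eq free_act_diff free_act_mult free_act_one free_act_const)
  from arg_cong[OF this, of "scale (q - inverse q)"] assms(2) show ?thesis
    by simp
qed

lemma tet_x_carrier [simp]: "tet_x q i j \<in> carrier (qtet q)"
  by (simp add: tet_x_def)

lemma act_diff:
  assumes "a \<in> carrier (qtet q)" "b \<in> carrier (qtet q)"
  shows "act (a \<ominus>\<^bsub>qtet q\<^esub> b) v = act a v - act b v"
proof -
  interpret Q: ring "qtet q" using coset_hom ring_hom_ring.axioms(2) by blast
  have "(a \<ominus>\<^bsub>qtet q\<^esub> b) \<oplus>\<^bsub>qtet q\<^esub> b = a"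
    using assms by (simp add: Q.minus_eq Q.a_assoc Q.l_neg)
  with act_add[of "a \<ominus>\<^bsub>qtet q\<^esub> b" b v] assms show ?thesis
    by (simp add: algebra_simps)
qed

lemma act_smult_diff:
  "act (tet_smult q c (tet_x q i j \<ominus>\<^bsub>qtet q\<^esub> tet_x q k l)) v = scale c (X i j v - X k l v)"
proof -
  interpret Q: ring "qtet q" using coset_hom ring_hom_ring.axioms(2) by blast
  show ?thesis by (simp add: act_smult act_diff)
qed

lemma act_smult_comm:
  "act (tet_smult q c (tet_comm q (tet_x q i j) (tet_x q k l))) v
     = scale c (X i j (X k l v) - X k l (X i j v))"
proof -
  interpret Q: ring "qtet q" using coset_hom ring_hom_ring.axioms(2) by blast
  show ?thesis by (simp add: tet_comm_def act_smult act_diff act_mult)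
qed

lemma X_add: "X i j (u + v) = X i j u + X i j v"
  by (simp add: X_eq free_act_vec_add)

lemma X_scale: "X i j (scale c v) = scale c (X i j v)"
  by (simp add: X_eq free_act_scale)

lemma X_zero: "X i j 0 = 0"
  using X_scale[of i j 0 0] by simp

lemma X_diff: "X i j (u - v) = X i j u - X i j v"
  using X_add[of i j "u - v" v] by simp

text \<open>
  The \<open>q\<close>-Weyl relation expresses \<open>x\<^sub>j\<^sub>k x\<^sub>i\<^sub>j\<close> through \<open>x\<^sub>i\<^sub>j x\<^sub>j\<^sub>k\<close> and \<open>1\<close>, and vice versa. Eliminating
  one of the two products from the commutator leaves a multiple of \<open>q - q\<^sup>-\<^sup>1\<close>.
\<close>

lemma q_commutator_left:
  assumes "(j - i, k - j) \<in> {(1, 1), (1, 2), (2, 1)}" "q \<noteq> 0" "q - inverse q \<noteq> 0"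
  shows "scale (inverse (q - inverse q)) (X i j (X j k v) - X j k (X i j v)) = scale q (v - X i j (X j k v))"
    (is "_ (?A - ?B) = _")
proof -
  from X_weyl[OF assms(1,3), of v]
  have "scale q (scale q ?A - scale (inverse q) ?B) = scale q (scale (q - inverse q) v)" by simp
  then have *: "?B = scale (q * q) ?A - scale (q * (q - inverse q)) v"
    using assms(2) by (simp add: scale_right_diff_distrib algebra_simps)
  have "?A - ?B = scale (q * (q - inverse q)) (v - ?A)"
    unfolding * using assms(2)
    by (simp add: scale_right_diff_distrib scale_left_diff_distrib algebra_simps)
  then show ?thesis using assms(3) by simp
qed

lemma q_commutator_right:
  assumes "(j - i, k - j) \<in> {(1, 1), (1, 2), (2, 1)}" "q \<noteq> 0" "q - inverse q \<noteq> 0"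
  shows "scale (inverse (q - inverse q)) (X i j (X j k v) - X j k (X i j v))
    = scale (inverse q) (v - X j k (X i j v))"
    (is "_ (?A - ?B) = _")
proof -
  from X_weyl[OF assms(1,3), of v]
  have "scale (inverse q) (scale q ?A - scale (inverse q) ?B) = scale (inverse q) (scale (q - inverse q) v)" by simp
  then have *: "?A = scale (inverse q * inverse q) ?B + scale (inverse q * (q - inverse q)) v"
    using assms(2) by (simp add: scale_right_diff_distrib algebra_simps)
  have "?A - ?B = scale (inverse q * (q - inverse q)) (v - ?B)"
    unfolding * using assms(2)
    by (simp add: scale_right_diff_distrib scale_left_diff_distrib algebra_simps)
  then show ?thesis using assms(3) by simp
qed

text \<open>
  Both sides are multiplied on the left by \<open>x\<^sub>l\<^sub>k\<close>, the inverse of \<open>x\<^sub>k\<^sub>l\<close>, and divided by \<open>- c e\<close>.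
\<close>

lemma product_relation_dual:
  assumes eq: "\<And>v. scale c (X i j v - X k l v) = scale e (v - X k l (X m n v))"
    and "l - k = 2" "c \<noteq> 0" "e \<noteq> 0"
  shows "scale (inverse c) (X m n v - X l k v) = scale (inverse e) (v - X l k (X i j v))"
proof -
  have "k - l = 2" using assms(2) by (metis minus_diff_eq minus_two_4)
  then have inv: "X l k (X k l u) = u" for u by (rule X_inverse)
  have "scale c (X l k (X i j v) - v) = scale e (X l k v - X m n v)"
    using arg_cong[OF eq[of v], of "X l k"] by (simp add: X_scale X_diff inv)
  then have "scale (inverse c * inverse e) (scale c (X l k (X i j v) - v)) =
     scale (inverse c * inverse e) (scale e (X l k v - X m n v))" by simp
  then have "scale (inverse e) (X l k (X i j v) - v) = scale (inverse c) (X l k v - X m n v)"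
    using assms by (simp add: field_simps)
  then have "- scale (inverse e) (X l k (X i j v) - v) = - scale (inverse c) (X l k v - X m n v)" by simp
  then show ?thesis by (simp add: scale_right_diff_distrib)
qed

end

section \<open>Conjugation by the reversal matrix\<close>

lemma mat_flip_entry:
  assumes "M \<in> carrier_mat (d + 1) (d + 1)" "i \<le> d" "j \<le> d"
  shows "(Z_mat d * M * Z_mat d :: 'f::field mat) $$ (i, j) = M $$ (d - i, d - j)"
proof -
  have Z: "(Z_mat d :: 'f mat) $$ (k, l) = (if k + l = d then 1 else 0)" if "k \<le> d" "l \<le> d" for k l
    using that by (simp add: Z_mat_def)
  have D: "dim_row M = d + 1" "dim_col M = d + 1" "dim_row (Z_mat d :: 'f mat) = d + 1"
      "dim_col (Z_mat d :: 'f mat) = d + 1"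
    using assms(1) by (auto simp: Z_mat_def)
  have ZM: "(Z_mat d * M) $$ (i, k) = M $$ (d - i, k)" if "k \<le> d" for k
  proof -
    have "(Z_mat d * M) $$ (i, k) = (\<Sum>l\<in>{0..<d + 1}. Z_mat d $$ (i, l) * M $$ (l, k))"
      using assms that by (simp add: D scalar_prod_def)
    also have "\<dots> = (\<Sum>l\<in>{0..<d + 1}. if l = d - i then M $$ (l, k) else 0)"
      using assms by (intro sum.cong) (auto simp: Z)
    finally show ?thesis using assms by simp
  qed
  have "(Z_mat d * M * Z_mat d) $$ (i, j) = (\<Sum>l\<in>{0..<d + 1}. (Z_mat d * M) $$ (i, l) * Z_mat d $$ (l, j))"
    using assms by (simp add: D scalar_prod_def del: index_mult_mat(1)) (simp add: D scalar_prod_def)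
  also have "\<dots> = (\<Sum>l\<in>{0..<d + 1}. if l = d - j then M $$ (d - i, l) else 0)"
    using assms by (intro sum.cong) (auto simp: Z ZM)
  finally show ?thesis using assms by simp
qed

text \<open>
  Conjugation by \<open>Z\<close> reverses the order of the basis, so it exchanges the superdiagonal and the
  subdiagonal. The functions \<open>f, g, h\<close> are indexed as in the matrices \<open>E, G, S\<close>: the superdiagonal by
  columns and the subdiagonal by rows.
\<close>

lemma flip_band:
  fixes f g h :: "nat \<Rightarrow> 'f::field"
  assumes M: "M = mat (d + 1) (d + 1) (\<lambda>(i, j). if i = j then f i
      else if j = i + 1 then g j else if i = j + 1 then h i else 0)"
    and mn: "m \<le> d" "n \<le> d"
  shows "(Z_mat d * M * Z_mat d) $$ (m, n) =
    (if m = n then f (d - n) else if n = m + 1 then h (d - m) else if m = n + 1 then g (d - n) else 0)"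
proof -
  have "M \<in> carrier_mat (d + 1) (d + 1)" by (simp add: M)
  then have "(Z_mat d * M * Z_mat d) $$ (m, n) = M $$ (d - m, d - n)"
    using mn by (rule mat_flip_entry)
  moreover have "d - m = d - n \<longleftrightarrow> m = n" "d - n = d - m + 1 \<longleftrightarrow> m = n + 1" "d - m = d - n + 1 \<longleftrightarrow> n = m + 1"
    using mn by arith+
  ultimately show ?thesis using mn by (simp only: M index_mat split less_Suc_eq_le Suc_eq_plus1[symmetric]) auto
qed

section \<open>The evaluation module on an integer-indexed basis\<close>

text \<open>
  The module \<open>V\<^sub>d(t)\<close> with its basis chosen. The generators \<open>x\<^sub>2\<^sub>0\<close> and \<open>x\<^sub>1\<^sub>3\<close> enter only as inverses
  of \<open>x\<^sub>0\<^sub>2\<close> and \<open>x\<^sub>3\<^sub>1\<close>, which the module laws already provide.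
\<close>

locale evaluation_module = qtet_module scale q act
  for scale :: "'f::field \<Rightarrow> 'v::ab_group_add \<Rightarrow> 'v" and q act +
  fixes d :: nat and t :: 'f and v :: "nat \<Rightarrow> 'v"
  assumes q_nonzero: "q \<noteq> 0" and q_minus_inverse: "q - inverse q \<noteq> 0" and t_nonzero: "t \<noteq> 0"
    and t_generic: "t \<notin> (\<lambda>n. q powi (int d - 2 * int n + 1)) ` {1..d}"
    and basis: "is_basis scale d v"
    and rep01: "represents scale d v (Z_mat d * S_mat d (inverse q) (inverse t) * Z_mat d) (act (tet_x q 0 1))"
    and rep12: "represents scale d v (E_mat d q) (act (tet_x q 1 2))"
    and rep23: "represents scale d v (K_mat d q) (act (tet_x q 2 3))"
    and rep30: "represents scale d v (Z_mat d * G_mat d (inverse q) t * Z_mat d) (act (tet_x q 3 0))"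
    and rep02: "represents scale d v (L_mat d q t) (act (tet_x q 0 2))"
    and rep31: "represents scale d v (Z_mat d * E_mat d (inverse q) * Z_mat d) (act (tet_x q 3 1))"
begin

text \<open>
  The basis padded with zeros to a family indexed by all integers. Then the neighbours \<open>w (k - 1)\<close> and
  \<open>w (k + 1)\<close> exist for every \<open>k\<close>, and the first and last columns of a matrix need no separate treatment.
\<close>

definition w :: "int \<Rightarrow> 'v" where
  "w k = (if 0 \<le> k \<and> k \<le> int d then v (nat k) else 0)"

lemma eq_on_w:
  assumes "\<And>k. 0 \<le> k \<Longrightarrow> k \<le> int d \<Longrightarrow> free_act a (w k) = free_act b (w k)"
  shows "free_act a u = free_act b u"
proof -
  interpret vector_space_pair scale scale ..
  have "u \<in> span (v ` {..d})" using basis by (simp add: is_basis_def)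
  then show ?thesis
  proof (rule linear_eq_on[OF free_act_linear free_act_linear])
    fix x assume "x \<in> v ` {..d}"
    then obtain n where "n \<le> d" "x = v n" by auto
    then show "free_act a x = free_act b x" using assms[of "int n"] by (simp add: w_def)
  qed
qed

text \<open>
  The formula holds for all integers \<open>k\<close>, also for \<open>k = -1\<close> and \<open>k = d + 1\<close>, where the left-hand
  side is \<open>0\<close> and a term with \<open>w 0\<close> or \<open>w d\<close> might survive on the right. The last two hypotheses say
  that it does not; the six matrices fixed above satisfy them. Hence a second operator can be applied to
  \<open>w (k - 1)\<close> and \<open>w (k + 1)\<close> without asking whether the index is still in range.
\<close>

lemma generator_on_w:
  assumes rep: "represents scale d v M (X i j)"
    and M: "\<And>m n. m \<le> d \<Longrightarrow> n \<le> d \<Longrightarrow> M $$ (m, n) =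
      (if m = n then \<alpha> (int n) else if n = m + 1 then \<beta> (int n) else if m = n + 1 then \<gamma> (int n) else 0)"
    and "\<beta> (int d + 1) = 0" "\<gamma> (- 1) = 0"
  shows "X i j (w k) = scale (\<beta> k) (w (k - 1)) + scale (\<alpha> k) (w k) + scale (\<gamma> k) (w (k + 1))"
proof -
  consider "0 \<le> k" "k \<le> int d" | "k = int d + 1" | "k = - 1" | "k < -1 \<or> k > int d + 1" by linarith
  then show ?thesis
  proof cases
    case 1
    define n where "n = nat k"
    have n: "k = int n" "n \<le> d" using 1 by (auto simp: n_def)
    have "X i j (w k) = (\<Sum>m\<le>d. scale (M $$ (m, n)) (v m))"
      using rep n by (simp add: represents_def w_def)
    also have "\<dots> = (\<Sum>m\<le>d. (if m = n then scale (\<alpha> k) (v m) else 0)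
        + (if n = m + 1 then scale (\<beta> k) (v m) else 0) + (if m = n + 1 then scale (\<gamma> k) (v m) else 0))"
      using n by (intro sum.cong) (auto simp: M)
    also have "\<dots> = scale (\<alpha> k) (w k) + (\<Sum>m\<le>d. if n = m + 1 then scale (\<beta> k) (v m) else 0)
        + scale (\<gamma> k) (w (k + 1))"
      using n by (auto simp: sum.distrib w_def nat_add_distrib)
    also have "(\<Sum>m\<le>d. if n = m + 1 then scale (\<beta> k) (v m) else 0) = scale (\<beta> k) (w (k - 1))"
      using n by (cases n) (auto simp: w_def)
    finally show ?thesis by (simp add: ac_simps)
  qed (use assms in \<open>auto simp: w_def X_zero\<close>)
qed

text \<open>
  With \<open>p = q\<^sup>d\<close> and \<open>a k = q\<^sup>2\<^sup>k\<close> every matrix entry is a rational function of \<open>q, t, p, a k\<close>, so that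
  identities between entries become identities of rational functions.
\<close>

definition p :: 'f where "p = q powi int d"
definition a :: "int \<Rightarrow> 'f" where "a k = q powi (2 * k)"

lemma p_nonzero: "p \<noteq> 0" and a_nonzero: "a k \<noteq> 0"
  using q_nonzero by (simp_all add: p_def a_def)

lemma powi_double: "q powi (2 * m) = (q powi m)\<^sup>2"
proof -
  have "q powi (2 * m) = q powi (m + m)" by (simp only: mult_2)
  also have "\<dots> = (q powi m)\<^sup>2" using q_nonzero power_int_add[of q m m] by (simp only: power2_eq_square simp_thms)
  finally show ?thesis .
qed

lemma powi_expand: "q powi (m + n) = q powi m * q powi n" "q powi (m - n) = q powi m / q powi n"
   "q powi (- m) = inverse (q powi m)" "inverse q powi m = inverse (q powi m)"
   "q powi (2 * m) = (q powi m)\<^sup>2"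
  using q_nonzero by (simp_all add: power_int_add power_int_diff power_int_minus power_int_inverse powi_double)

lemma a_shift: "a (k + 1) = q\<^sup>2 * a k"
  by (simp only: a_def powi_expand power_int_1_right power_mult_distrib) (simp only: mult.commute)

lemma a_top: "a (int d + 1) = q\<^sup>2 * p\<^sup>2"
  by (simp only: a_def p_def powi_expand power_int_1_right power_mult_distrib) (simp only: mult.commute)

lemma a_bot: "a 0 = 1"
  by (simp add: a_def)

text \<open>
  The exponents that occur in column \<open>k\<close> of \<open>K, E, L\<close>. The power \<open>q ^ d\<close> is the form into which
  simplification turns \<open>q powi int d\<close>.
\<close>

lemma powi_column:
  "q powi int d = p" "q powi (2 * k - int d) = a k / p"
  "q powi (int d - 2 * k) = p / a k" "q powi (2 * k - 2 - int d) = a k / (q\<^sup>2 * p)"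
  "q powi (int d - 2 * k + 1) = p * q / a k"
  "q ^ d = p"
  using q_nonzero by (simp_all add: p_def a_def powi_expand(1,2) mult.commute)

text \<open>
  The exponents that occur in \<open>E, G, S\<close> at the reversed index \<open>d - n\<close>, with \<open>q\<close> replaced by its inverse:
  the two replacements nearly cancel, since \<open>-(2 (d - n) - d) = 2 n - d\<close>.
\<close>

lemma powi_flip:
  assumes "n \<le> d"
  shows "inverse q powi (2 * int (d - n) - int d) = a (int n) / p" (is ?A)
    and "inverse q powi (2 * int (d - n) - int d - 1) = a (int n) * q / p" (is ?B)
    and "inverse q powi (2 * int (d - n) - int d + 1) = a (int n) / (p * q)" (is ?C)
    and "inverse q powi (2 * int (d - n) - int d - 2) = a (int n) * q\<^sup>2 / p" (is ?D)
    and "inverse q powi (2 * int (d - n) - 2 - int d) = a (int n) * q\<^sup>2 / p" (is ?E)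
    and "inverse q powi (int d - 2 * int (d - n) + 1) = p / (a (int n) * q)" (is ?F)
proof -
  have *: "2 * int (d - n) - int d = int d - 2 * int n" using assms by linarith
  have A: "q powi (2 * int (d - n) - int d) = p / a (int n)"
    unfolding * by (simp add: powi_column)
  show ?A ?B ?C ?D
    unfolding powi_expand(4) powi_expand(1)[of _ 1] powi_expand(2)[of _ 1] powi_expand(2)[of _ 2] A
    by simp_all
  then show ?E by (simp add: algebra_simps)
  have "int d - 2 * int (d - n) + 1 = 2 * int n - int d + 1" using assms by linarith
  then have "q powi (int d - 2 * int (d - n) + 1) = a (int n) / p * q"
    by (simp only: powi_expand(1) powi_column power_int_1_right)
  then show ?F unfolding powi_expand(4) by simp
qed

lemma powi_end: "inverse q powi int d = 1 / p" "inverse q powi (- int d) = p" "inverse q ^ d = 1 / p"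
proof -
  show A: "inverse q powi int d = 1 / p"
    unfolding powi_expand(4) powi_column by (simp add: inverse_eq_divide)
  show "inverse q powi (- int d) = p"
    unfolding powi_expand(4) powi_expand(3) powi_column by simp
  show "inverse q ^ d = 1 / p" using A by simp
qed

lemma a_Suc: "a (1 + k) = q\<^sup>2 * a k"
  using a_shift[of k] by (simp add: add.commute)

text \<open>
  The factor by which the off-diagonal entries of \<open>x\<^sub>3\<^sub>0\<close> differ from those of \<open>x\<^sub>3\<^sub>1\<close>; those of \<open>x\<^sub>0\<^sub>2\<close>
  differ from those of \<open>x\<^sub>1\<^sub>2\<close> by its inverse. The assumption on
  \<open>t\<close> is that it does not vanish for \<open>1 \<le> k \<le> d\<close>.
\<close>

definition h :: "int \<Rightarrow> 'f" where "h k = 1 - t * p * q / a k"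

lemma h_nonzero:
  assumes "1 \<le> k" "k \<le> int d"
  shows "h k \<noteq> 0"
proof
  assume "h k = 0"
  then have "t = a k / (p * q)" using p_nonzero a_nonzero[of k] q_nonzero by (simp add: h_def field_simps)
  define n where "n = nat (int d + 1 - k)"
  have n: "int n = int d + 1 - k" "n \<in> {1..d}" using assms by (auto simp: n_def)
  have "q powi (int d - 2 * int n + 1) = q powi (2 * k - int d - 1)" unfolding n by (simp add: algebra_simps)
  also have "\<dots> = a k / (p * q)" unfolding powi_expand(2)[of _ 1] powi_column by simp
  finally have "t = q powi (int d - 2 * int n + 1)" using \<open>t = a k / (p * q)\<close> by (simp only:)
  then have "t \<in> (\<lambda>n. q powi (int d - 2 * int n + 1)) ` {1..d}" using n(2) by (rule image_eqI)
  with t_generic show False ..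
qed

lemma act12: "X 1 2 (w k) = scale (p - a k / (q\<^sup>2 * p)) (w (k - 1)) + scale (a k / p) (w k)"
proof -
  let ?M = "E_mat d q"
  have entry: "?M $$ (m, n) = (if m = n then a (int n) / p
      else if n = m + 1 then p - a (int n) / (q\<^sup>2 * p) else if m = n + 1 then 0 else 0)"
    if "m \<le> d" "n \<le> d" for m n
    using that by (simp add: E_mat_def powi_column del: of_nat_Suc)
  show ?thesis
    using generator_on_w[OF rep12 entry, where k = k] p_nonzero q_nonzero by (simp add: a_top power2_eq_square)
qed

lemma act23: "X 2 3 (w k) = scale (p / a k) (w k)"
proof -
  let ?M = "K_mat d q"
  have entry: "?M $$ (m, n) = (if m = n then p / a (int n)
      else if n = m + 1 then 0 else if m = n + 1 then 0 else 0)"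
    if "m \<le> d" "n \<le> d" for m n
    using that by (simp add: K_mat_def powi_column)
  show ?thesis
    using generator_on_w[OF rep23 entry, where k = k] by simp
qed

lemma act02: "X 0 2 (w k) = scale ((p - a k / (q\<^sup>2 * p)) * inverse (h k)) (w (k - 1)) + scale (a k / p) (w k)"
proof -
  let ?M = "L_mat d q t"
  have entry: "?M $$ (m, n) = (if m = n then a (int n) / p
      else if n = m + 1 then (p - a (int n) / (q\<^sup>2 * p)) * inverse (h (int n)) else if m = n + 1 then 0 else 0)"
    if "m \<le> d" "n \<le> d" for m n
    using that by (simp add: L_mat_def powi_column h_def mult.assoc del: of_nat_Suc)
  show ?thesis
    using generator_on_w[OF rep02 entry, where k = k] p_nonzero q_nonzero by (simp add: a_top power2_eq_square)
qed

lemma act31: "X 3 1 (w k) = scale (a k / p) (w k) + scale ((1 - a (k + 1)) / p) (w (k + 1))"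
proof -
  have E: "E_mat d (inverse q) = mat (d + 1) (d + 1) (\<lambda>(i, j).
      if i = j then inverse q powi (2 * int i - int d)
      else if j = i + 1 then inverse q powi int d - inverse q powi (2 * int j - 2 - int d)
      else if i = j + 1 then 0 else 0)"
    unfolding E_mat_def by (intro cong_mat) auto
  let ?M = "Z_mat d * E_mat d (inverse q) * Z_mat d"
  have entry: "?M $$ (m, n) = (if m = n then a (int n) / p else if n = m + 1 then 0
      else if m = n + 1 then (1 - a (int n + 1)) / p else 0)"
    if "m \<le> d" "n \<le> d" for m n
    unfolding flip_band[OF E that] using that
    by (simp add: powi_flip powi_end a_shift diff_divide_distrib mult.commute del: of_nat_diff)
  show ?thesis
    using generator_on_w[OF rep31 entry, where k = k] by (simp add: a_bot)
qed

lemma act30: "X 3 0 (w k) = scale (a k / p) (w k) + scale ((1 - a (k + 1)) / p * h (k + 1)) (w (k + 1))"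
proof -
  have G: "G_mat d (inverse q) t = mat (d + 1) (d + 1) (\<lambda>(i, j).
      if i = j then inverse q powi (2 * int i - int d)
      else if j = i + 1 then (inverse q powi int d - inverse q powi (2 * int j - 2 - int d)) *
        (1 - t * inverse q powi (int d - 2 * int j + 1))
      else if i = j + 1 then 0 else 0)"
    unfolding G_mat_def by (intro cong_mat) auto
  let ?M = "Z_mat d * G_mat d (inverse q) t * Z_mat d"
  have entry: "?M $$ (m, n) = (if m = n then a (int n) / p else if n = m + 1 then 0
      else if m = n + 1 then (1 - a (int n + 1)) / p * h (int n + 1) else 0)"
    if "m \<le> d" "n \<le> d" for m n
    unfolding flip_band[OF G that] using that q_nonzero a_nonzero[of "int n"]
    by (simp add: powi_flip powi_end a_shift h_def diff_divide_distrib mult.commute power2_eq_square del: of_nat_diff)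
  show ?thesis
    using generator_on_w[OF rep30 entry, where k = k] by (simp add: a_bot)
qed

lemma act01: "X 0 1 (w k) =
    scale ((a k / (q\<^sup>2 * p) - p) * (a k / (p * q * t))) (w (k - 1))
  + scale (1 / p - (a k / p - p) * (a k * q / p) / t - (1 - a k) / p * (1 - a k / (p * q * t))) (w k)
  + scale ((1 - a (k + 1)) / p * (1 - a (k + 1) / (p * q * t))) (w (k + 1))"
proof -
  let ?r = "inverse q" and ?s = "inverse t"
  have S: "S_mat d ?r ?s = mat (d + 1) (d + 1) (\<lambda>(i, j).
      if i = j then ?r powi int d
         - (?r powi (2 * int i - int d) - ?r powi (- int d)) * ?r powi (2 * int i - int d - 1) * ?s
         - (?r powi int d - ?r powi (2 * int i - int d)) * (1 - ?s * ?r powi (2 * int i - int d + 1))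
      else if j = i + 1 then
        (?r powi int d - ?r powi (2 * int j - int d - 2)) * (1 - ?s * ?r powi (2 * int j - int d - 1))
      else if i = j + 1 then
        (?r powi (2 * int i - int d) - ?r powi (- int d)) * ?r powi (2 * int i - int d - 1) * ?s
      else 0)"
    unfolding S_mat_def by (intro cong_mat) auto
  let ?M = "Z_mat d * S_mat d ?r ?s * Z_mat d"
  have entry: "?M $$ (m, n) = (if m = n then 1 / p - (a (int n) / p - p) * (a (int n) * q / p) / t
        - (1 - a (int n)) / p * (1 - a (int n) / (p * q * t))
    else if n = m + 1 then (a (int n) / (q\<^sup>2 * p) - p) * (a (int n) / (p * q * t))
    else if m = n + 1 then (1 - a (int n + 1)) / p * (1 - a (int n + 1) / (p * q * t)) else 0)"
    if "m \<le> d" "n \<le> d" for m n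
  proof -
    consider "m = n" | "n = m + 1" | "m = n + 1" | "m \<noteq> n" "n \<noteq> m + 1" "m \<noteq> n + 1" by blast
    then show ?thesis
    proof cases
      case 1
      then show ?thesis using that p_nonzero q_nonzero t_nonzero
        unfolding flip_band[OF S that] by (simp add: powi_flip powi_end del: of_nat_diff) (simp add: field_simps)
    next
      case 2
      then show ?thesis using that p_nonzero q_nonzero t_nonzero
        unfolding flip_band[OF S that] by (simp add: powi_flip powi_end a_Suc del: of_nat_diff) (simp add: field_simps power2_eq_square)
    next
      case 3
      then show ?thesis using that p_nonzero q_nonzero t_nonzero
        unfolding flip_band[OF S that] by (simp add: powi_flip powi_end a_shift del: of_nat_diff) (simp add: field_simps power2_eq_square)
    qed (simp add: flip_band[OF S that])
  qed
  show ?thesis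
    using generator_on_w[OF rep01 entry, where k = k] p_nonzero q_nonzero
    by (simp add: a_bot a_top power2_eq_square)
qed

section \<open>The four product relations\<close>

lemma act_upper_lower:
  assumes "X i j y = scale U x + scale M y" "X i j z = scale U' y + scale M' z"
  shows "X i j (scale \<alpha> y + scale \<gamma> z)
    = scale (\<alpha> * U) x + scale (\<alpha> * M + \<gamma> * U') y + scale (\<gamma> * M') z"
  by (simp add: X_add X_scale assms scale_right_distrib scale_left_distrib)

lemma act_lower_upper:
  assumes "X i j y = scale M y + scale L z" "X i j x = scale M' x + scale L' y"
  shows "X i j (scale \<beta> x + scale \<alpha> y)
    = scale (\<beta> * M') x + scale (\<beta> * L' + \<alpha> * M) y + scale (\<alpha> * L) z"
  by (simp add: X_add X_scale assms scale_right_distrib scale_left_distrib)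

text \<open>
  Comparison of coefficients. Here \<open>y\<close> is a basis vector with neighbours \<open>x\<close> and \<open>z\<close>, and \<open>A, B, C\<close>
  stand for the values at \<open>y\<close> of the two operators on the left of a product relation and of the
  product on its right. The alternative \<open>x = 0\<close> covers the first basis vector: there the coefficients of \<open>x\<close>
  contain \<open>1 / h 0\<close>, and \<open>h 0\<close> may be \<open>0\<close>.
\<close>

lemma three_term_eq:
  assumes "A = scale u1 x + scale m1 y + scale l1 z" "B = scale u2 x + scale m2 y + scale l2 z"
    "C = scale u3 x + scale m3 y + scale l3 z"
    and u: "x = 0 \<or> c * (u1 - u2) = - (e * u3)" and m: "c * (m1 - m2) = e * (1 - m3)" and l: "c * (l1 - l2) = - (e * l3)"
  shows "scale c (A - B) = scale e (y - C)"
proof -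
  have "scale c (A - B) = scale (c * (u1 - u2)) x + scale (c * (m1 - m2)) y + scale (c * (l1 - l2)) z"
    unfolding assms(1,2)
    by (simp add: scale_right_distrib scale_right_diff_distrib scale_left_diff_distrib right_diff_distrib)
  also have "scale (c * (u1 - u2)) x = scale (- (e * u3)) x" using u by auto
  also have "scale (- (e * u3)) x + scale (c * (m1 - m2)) y + scale (c * (l1 - l2)) z = scale e (y - C)"
    unfolding assms(3) m l
    by (simp add: scale_right_distrib scale_right_diff_distrib scale_left_diff_distrib right_diff_distrib)
  finally show ?thesis .
qed

text \<open>
  The factor \<open>h\<close> in the entries of \<open>x\<^sub>3\<^sub>0\<close> cancels against \<open>1 / h\<close> in those of \<open>x\<^sub>0\<^sub>2\<close> on the diagonal of the
  product.
\<close>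

lemma product_01_02_30_basis:
  assumes "0 \<le> k" "k \<le> int d"
  shows "scale t (X 0 1 (w k) - X 0 2 (w k)) = scale (inverse q) (w k - X 0 2 (X 3 0 (w k)))"
proof (rule three_term_eq[OF act01])
  show "X 0 2 (w k) = scale ((p - a k / (q\<^sup>2 * p)) * inverse (h k)) (w (k - 1)) + scale (a k / p) (w k)
    + scale 0 (w (k + 1))" by (simp add: act02)
  show "X 0 2 (X 3 0 (w k)) =
     scale (a k / p * ((p - a k / (q\<^sup>2 * p)) * inverse (h k))) (w (k - 1))
   + scale (a k / p * (a k / p) + (1 - a (k + 1)) / p * h (k + 1) * ((p - a (k + 1) / (q\<^sup>2 * p)) * inverse (h (k + 1)))) (w k)
   + scale ((1 - a (k + 1)) / p * h (k + 1) * (a (k + 1) / p)) (w (k + 1))"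
    unfolding act30 by (rule act_upper_lower[OF act02 act02[of "k + 1", unfolded add_diff_cancel_right']])
  show "w (k - 1) = 0 \<or> t * ((a k / (q\<^sup>2 * p) - p) * (a k / (p * q * t)) - (p - a k / (q\<^sup>2 * p)) * inverse (h k))
     = - (inverse q * (a k / p * ((p - a k / (q\<^sup>2 * p)) * inverse (h k))))"
  proof (cases "k = 0")
    case False
    define u s Y where "u = p - a k / (q\<^sup>2 * p)" and "s = a k / (p * q)" and "Y = u * inverse (h k)"
    have h: "h k \<noteq> 0" using assms False by (intro h_nonzero) auto
    \<comment> \<open>The terms with \<open>1 / h k\<close>, one from \<open>x\<^sub>0\<^sub>2\<close> and one from the product, combine with the coefficient
      \<open>t - s\<close>. It has the factor \<open>h k\<close>, which cancels the denominator.\<close>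
    have "t - a k / (p * q) = - (a k / (p * q)) * h k"
      using p_nonzero q_nonzero a_nonzero[of k] by (simp add: h_def field_simps)
    then have "(t - s) * Y = - s * h k * (u * inverse (h k))"
      by (simp only: Y_def s_def)
    with h have Y: "(t - s) * Y = - (s * u)" by simp
    have A: "t * ((a k / (q\<^sup>2 * p) - p) * (a k / (p * q * t))) = - (s * u)"
      using t_nonzero p_nonzero q_nonzero by (simp add: u_def s_def field_simps)
    have "t * ((a k / (q\<^sup>2 * p) - p) * (a k / (p * q * t)) - Y) = - (s * u) - t * Y"
      by (simp only: right_diff_distrib[of t] A)
    also have "\<dots> = - (s * Y)"
      unfolding Y[symmetric] by (simp add: algebra_simps)
    also have "\<dots> = - (inverse q * (a k / p * Y))"
      by (simp add: s_def divide_inverse ac_simps)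
    finally show ?thesis unfolding Y_def u_def by (rule disjI2)
  qed (simp add: w_def)
  \<comment> \<open>For \<open>k = d\<close> the factor \<open>h (d + 1)\<close> may be \<open>0\<close>, but there both sides vanish, by \<open>a (d + 1) = q\<^sup>2 p\<^sup>2\<close>.\<close>
  have cancel: "h (k + 1) * ((p - a (k + 1) / (q\<^sup>2 * p)) * inverse (h (k + 1))) = p - a (k + 1) / (q\<^sup>2 * p)"
  proof (cases "k = int d")
    case True
    then show ?thesis using p_nonzero q_nonzero by (simp add: a_top power2_eq_square)
  next
    case False
    then have "h (k + 1) \<noteq> 0" using assms by (intro h_nonzero) auto
    then show ?thesis by simp
  qed
  show "t * (1 / p - (a k / p - p) * (a k * q / p) / t - (1 - a k) / p * (1 - a k / (p * q * t)) - a k / p)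
    = inverse q * (1 - (a k / p * (a k / p) + (1 - a (k + 1)) / p * h (k + 1) * ((p - a (k + 1) / (q\<^sup>2 * p)) * inverse (h (k + 1)))))"
    unfolding mult.assoc[of _ "h (k + 1)"] cancel
    using p_nonzero q_nonzero t_nonzero by (simp only: a_shift, simp add: field_simps power2_eq_square)
  show "t * ((1 - a (k + 1)) / p * (1 - a (k + 1) / (p * q * t)) - 0)
    = - (inverse q * ((1 - a (k + 1)) / p * h (k + 1) * (a (k + 1) / p)))"
    using p_nonzero q_nonzero t_nonzero a_nonzero[of "k + 1"] by (simp add: h_def field_simps)
qed

lemma product_01_31_12_basis:
  "scale t (X 0 1 (w k) - X 3 1 (w k)) = scale q (w k - X 3 1 (X 1 2 (w k)))"
proof (rule three_term_eq[OF act01])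
  show "X 3 1 (w k) = scale 0 (w (k - 1)) + scale (a k / p) (w k) + scale ((1 - a (k + 1)) / p) (w (k + 1))"
    by (simp add: act31)
  show "X 3 1 (X 1 2 (w k)) =
     scale ((p - a k / (q\<^sup>2 * p)) * (a (k - 1) / p)) (w (k - 1))
   + scale ((p - a k / (q\<^sup>2 * p)) * ((1 - a k) / p) + a k / p * (a k / p)) (w k)
   + scale (a k / p * ((1 - a (k + 1)) / p)) (w (k + 1))"
    unfolding act12 by (rule act_lower_upper[OF act31 act31[of "k - 1", unfolded diff_add_cancel]])
  have shift: "a k = q\<^sup>2 * a (k - 1)" using a_shift[of "k - 1"] by simp
  show "w (k - 1) = 0 \<or> t * ((a k / (q\<^sup>2 * p) - p) * (a k / (p * q * t)) - 0)
     = - (q * ((p - a k / (q\<^sup>2 * p)) * (a (k - 1) / p)))"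
    unfolding shift using p_nonzero q_nonzero t_nonzero by (simp add: field_simps power2_eq_square)
  show "t * (1 / p - (a k / p - p) * (a k * q / p) / t - (1 - a k) / p * (1 - a k / (p * q * t)) - a k / p)
    = q * (1 - ((p - a k / (q\<^sup>2 * p)) * ((1 - a k) / p) + a k / p * (a k / p)))"
    using p_nonzero q_nonzero t_nonzero by (simp add: field_simps power2_eq_square)
  show "t * ((1 - a (k + 1)) / p * (1 - a (k + 1) / (p * q * t)) - (1 - a (k + 1)) / p)
    = - (q * (a k / p * ((1 - a (k + 1)) / p)))"
    using p_nonzero q_nonzero t_nonzero by (simp only: a_shift, simp add: field_simps power2_eq_square)
qed

lemma product_12_02_23_basis:
  assumes "0 \<le> k" "k \<le> int d"
  shows "scale (inverse t) (X 1 2 (w k) - X 0 2 (w k)) = scale q (w k - X 0 2 (X 2 3 (w k)))"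
proof (rule three_term_eq)
  show "X 1 2 (w k) = scale (p - a k / (q\<^sup>2 * p)) (w (k - 1)) + scale (a k / p) (w k)
    + scale 0 (w (k + 1))" by (simp add: act12)
  show "X 0 2 (w k) = scale ((p - a k / (q\<^sup>2 * p)) * inverse (h k)) (w (k - 1)) + scale (a k / p) (w k)
    + scale 0 (w (k + 1))" by (simp add: act02)
  show "X 0 2 (X 2 3 (w k)) =
     scale (p / a k * ((p - a k / (q\<^sup>2 * p)) * inverse (h k))) (w (k - 1)) + scale 1 (w k) + scale 0 (w (k + 1))"
    unfolding act23 X_scale act02 using p_nonzero a_nonzero[of k] by (simp add: scale_right_distrib)
  show "w (k - 1) = 0 \<or> inverse t * (p - a k / (q\<^sup>2 * p) - (p - a k / (q\<^sup>2 * p)) * inverse (h k))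
     = - (q * (p / a k * ((p - a k / (q\<^sup>2 * p)) * inverse (h k))))"
  proof (cases "k = 0")
    case False
    define u where "u = p - a k / (q\<^sup>2 * p)"
    have h: "h k \<noteq> 0" using assms False by (intro h_nonzero) auto
    have "inverse t * (h k - 1) = - (q * (p / a k))"
      using t_nonzero by (simp add: h_def)
    then have "inverse t * ((h k - 1) * (u * inverse (h k))) = - (q * (p / a k * (u * inverse (h k))))"
      by (simp only: mult.assoc[symmetric] mult_minus_left)
    moreover have "(h k - 1) * (u * inverse (h k)) = u - u * inverse (h k)"
      using h by (simp add: left_diff_distrib)
    ultimately show ?thesis unfolding u_def[symmetric] by (intro disjI2) (simp only:)
  qed (simp add: w_def)
  show "inverse t * (a k / p - a k / p) = q * (1 - 1)" "inverse t * (0 - 0) = - (q * 0)"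
    by simp_all
qed

lemma product_30_31_23_basis:
  "scale (inverse t) (X 3 0 (w k) - X 3 1 (w k)) = scale (inverse q) (w k - X 3 1 (X 2 3 (w k)))"
proof (rule three_term_eq)
  show "X 3 0 (w k) = scale 0 (w (k - 1)) + scale (a k / p) (w k) + scale ((1 - a (k + 1)) / p * h (k + 1)) (w (k + 1))"
    by (simp add: act30)
  show "X 3 1 (w k) = scale 0 (w (k - 1)) + scale (a k / p) (w k) + scale ((1 - a (k + 1)) / p) (w (k + 1))"
    by (simp add: act31)
  show "X 3 1 (X 2 3 (w k)) =
     scale 0 (w (k - 1)) + scale 1 (w k) + scale (p / a k * ((1 - a (k + 1)) / p)) (w (k + 1))"
    unfolding act23 X_scale act31 using p_nonzero a_nonzero[of k] by (simp add: scale_right_distrib)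
  show "inverse t * ((1 - a (k + 1)) / p * h (k + 1) - (1 - a (k + 1)) / p)
     = - (inverse q * (p / a k * ((1 - a (k + 1)) / p)))"
    using p_nonzero q_nonzero t_nonzero a_nonzero[of k] by (simp only: h_def a_shift, simp add: field_simps power2_eq_square)
  show "w (k - 1) = 0 \<or> inverse t * (0 - 0) = - (inverse q * 0)"
    "inverse t * (a k / p - a k / p) = inverse q * (1 - 1)"
    by simp_all
qed

lemma product_relation_from_basis:
  assumes "\<And>k. 0 \<le> k \<Longrightarrow> k \<le> int d \<Longrightarrow>
    scale c (X i j (w k) - X r s (w k)) = scale e (w k - X r s (X m n (w k)))"
  shows "scale c (X i j u - X r s u) = scale e (u - X r s (X m n u))"
proof -
  have "free_act (free_const c * (free_x i j - free_x r s)) u = free_act (free_const e * (1 - free_x r s * free_x m n)) u"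
  proof (rule eq_on_w)
    fix k assume "0 \<le> k" "k \<le> int d"
    from assms[OF this] show "free_act (free_const c * (free_x i j - free_x r s)) (w k)
        = free_act (free_const e * (1 - free_x r s * free_x m n)) (w k)"
      by (simp only: free_act_mult free_act_const free_act_diff free_act_one X_eq)
  qed
  then show ?thesis
    by (simp only: free_act_mult free_act_const free_act_diff free_act_one X_eq)
qed

lemma product_01_02_30:
  "scale t (X 0 1 u - X 0 2 u) = scale (inverse q) (u - X 0 2 (X 3 0 u))"
  by (rule product_relation_from_basis) (rule product_01_02_30_basis)

lemma product_01_31_12:
  "scale t (X 0 1 u - X 3 1 u) = scale q (u - X 3 1 (X 1 2 u))"
  by (rule product_relation_from_basis) (rule product_01_31_12_basis)

lemma product_12_02_23:
  "scale (inverse t) (X 1 2 u - X 0 2 u) = scale q (u - X 0 2 (X 2 3 u))"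
  by (rule product_relation_from_basis) (rule product_12_02_23_basis)

lemma product_30_31_23:
  "scale (inverse t) (X 3 0 u - X 3 1 u) = scale (inverse q) (u - X 3 1 (X 2 3 u))"
  by (rule product_relation_from_basis) (rule product_30_31_23_basis)

end

section \<open>The commutator identities\<close>

theorem lemma9p5:
  fixes q t :: "'f::alg_closed_field"
    and d :: nat
    and scale :: "'f \<Rightarrow> 'v::ab_group_add \<Rightarrow> 'v"
    and act :: "'f tet_free set \<Rightarrow> 'v \<Rightarrow> 'v"
  assumes "q \<noteq> 0" and "\<forall>n::nat. n > 0 \<longrightarrow> q ^ n \<noteq> 1"
    and "d \<ge> 1"
    and "t \<noteq> 0" and "t \<notin> (\<lambda>n. q powi (int d - 2 * int n + 1)) ` {1..d}"
    and "is_V scale q act d t"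
  shows "
     (act (tet_smult q t (tet_x q 0 1 \<ominus>\<^bsub>qtet q\<^esub> tet_x q 0 2))
        = act (tet_smult q (inverse (q - inverse q)) (tet_comm q (tet_x q 3 0) (tet_x q 0 2)))) \<and>
     (act (tet_smult q (inverse t) (tet_x q 1 2 \<ominus>\<^bsub>qtet q\<^esub> tet_x q 1 3))
        = act (tet_smult q (inverse (q - inverse q)) (tet_comm q (tet_x q 0 1) (tet_x q 1 3)))) \<and>
     (act (tet_smult q t (tet_x q 2 3 \<ominus>\<^bsub>qtet q\<^esub> tet_x q 2 0))
        = act (tet_smult q (inverse (q - inverse q)) (tet_comm q (tet_x q 1 2) (tet_x q 2 0)))) \<and>
     (act (tet_smult q (inverse t) (tet_x q 3 0 \<ominus>\<^bsub>qtet q\<^esub> tet_x q 3 1))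
        = act (tet_smult q (inverse (q - inverse q)) (tet_comm q (tet_x q 2 3) (tet_x q 3 1)))) \<and>
     (act (tet_smult q (inverse t) (tet_x q 3 0 \<ominus>\<^bsub>qtet q\<^esub> tet_x q 2 0))
        = act (tet_smult q (inverse (q - inverse q)) (tet_comm q (tet_x q 2 0) (tet_x q 0 1)))) \<and>
     (act (tet_smult q t (tet_x q 0 1 \<ominus>\<^bsub>qtet q\<^esub> tet_x q 3 1))
        = act (tet_smult q (inverse (q - inverse q)) (tet_comm q (tet_x q 3 1) (tet_x q 1 2)))) \<and>
     (act (tet_smult q (inverse t) (tet_x q 1 2 \<ominus>\<^bsub>qtet q\<^esub> tet_x q 0 2))
        = act (tet_smult q (inverse (q - inverse q)) (tet_comm q (tet_x q 0 2) (tet_x q 2 3)))) \<and>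
     (act (tet_smult q t (tet_x q 2 3 \<ominus>\<^bsub>qtet q\<^esub> tet_x q 1 3))
        = act (tet_smult q (inverse (q - inverse q)) (tet_comm q (tet_x q 1 3) (tet_x q 3 0))))"
proof -
  have "q ^ 2 \<noteq> 1" using assms(2) by (metis pos2)
  have q: "q - inverse q \<noteq> 0"
  proof
    assume "q - inverse q = 0"
    then have "q * q = q * inverse q" by simp
    with \<open>q ^ 2 \<noteq> 1\<close> assms(1) show False by (simp add: power2_eq_square)
  qed
  from assms(6) obtain v where mod: "qtet_module scale q act" and v: "is_basis scale d v"
    "represents scale d v (Z_mat d * S_mat d (inverse q) (inverse t) * Z_mat d) (act (tet_x q 0 1))"
    "represents scale d v (E_mat d q) (act (tet_x q 1 2))"
    "represents scale d v (K_mat d q) (act (tet_x q 2 3))"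
    "represents scale d v (Z_mat d * G_mat d (inverse q) t * Z_mat d) (act (tet_x q 3 0))"
    "represents scale d v (L_mat d q t) (act (tet_x q 0 2))"
    "represents scale d v (Z_mat d * E_mat d (inverse q) * Z_mat d) (act (tet_x q 3 1))"
    unfolding is_V_def by (elim conjE exE) rule
  have "evaluation_module scale q act d t v"
    by (intro evaluation_module.intro evaluation_module_axioms.intro mod v assms(1,4,5) q)
  then interpret evaluation_module scale q act d t v .
  show ?thesis
  proof (intro conjI ext; unfold act_smult_diff act_smult_comm)
    fix u
    show "scale t (X 0 1 u - X 0 2 u) = scale (inverse (q - inverse q)) (X 3 0 (X 0 2 u) - X 0 2 (X 3 0 u))"
      using assms(1) q by (simp add: q_commutator_right product_01_02_30)
    show "scale (inverse t) (X 1 2 u - X 1 3 u) = scale (inverse (q - inverse q)) (X 0 1 (X 1 3 u) - X 1 3 (X 0 1 u))"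
      using assms(1,4) q by (simp add: q_commutator_right product_relation_dual[OF product_01_31_12])
    show "scale t (X 2 3 u - X 2 0 u) = scale (inverse (q - inverse q)) (X 1 2 (X 2 0 u) - X 2 0 (X 1 2 u))"
      using assms(1,4) q product_relation_dual[OF product_12_02_23, of u] by (simp add: q_commutator_right)
    show "scale (inverse t) (X 3 0 u - X 3 1 u) = scale (inverse (q - inverse q)) (X 2 3 (X 3 1 u) - X 3 1 (X 2 3 u))"
      using assms(1) q by (simp add: q_commutator_right product_30_31_23)
    show "scale (inverse t) (X 3 0 u - X 2 0 u) = scale (inverse (q - inverse q)) (X 2 0 (X 0 1 u) - X 0 1 (X 2 0 u))"
      using assms(1,4) q product_relation_dual[OF product_01_02_30, of u] by (simp add: q_commutator_left)
    show "scale t (X 0 1 u - X 3 1 u) = scale (inverse (q - inverse q)) (X 3 1 (X 1 2 u) - X 1 2 (X 3 1 u))"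
      using assms(1) q by (simp add: q_commutator_left product_01_31_12)
    show "scale (inverse t) (X 1 2 u - X 0 2 u) = scale (inverse (q - inverse q)) (X 0 2 (X 2 3 u) - X 2 3 (X 0 2 u))"
      using assms(1) q by (simp add: q_commutator_left product_12_02_23)
    show "scale t (X 2 3 u - X 1 3 u) = scale (inverse (q - inverse q)) (X 1 3 (X 3 0 u) - X 3 0 (X 1 3 u))"
      using assms(1,4) q product_relation_dual[OF product_30_31_23, of u] by (simp add: q_commutator_left)
  qed
qed

end
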